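(* Let $(M^n,P)$ be a regular Poisson manifold with a pseudo-Riemannian metric $g$ whose restriction to each symplectic leaf is non-degenerate. Let $A$ be the $(1,1)$-tensor field $A^\tau_\mu=P^{\tau\sigma}g_{\sigma\mu}$, let $v:TM\to T(\mathcal S)$ be the $g$-orthogonal projection, and let $N_v$ be the Nijenhuis torsion of $v$. Then there exists a (not unique) invertible linear automorphism $D$ of the bundle $TM$ (inducing the identity on $M$) such that for all vector fields $\xi,\eta\in\Gamma(\mathcal N)$, $$A[\xi,\eta]=D\big(N_v(\xi,\eta)\big).$$ Thus $N_v|_{\mathcal N\times\mathcal N}\equiv 0$ if and only if $A[\xi,\eta]=0$ for all $\xi,\eta\in\Gamma(\mathcal N)$.
   Context: Regular Poisson manifold: an $n$-dimensional manifold $M$ with a Poisson bivector $P=(P^{\tau\sigma})$ of constant rank $k$, $2\le k<n$. $P$ is viewed as a bundle map $T^*M\to TM$, $(P\alpha)^\tau=P^{\tau\sigma}\alpha_\sigma$; its image $T(\mathcal S)$ is the integrable distribution of tangent spaces to the symplectic leaves. $\mathcal N=T(\mathcal S)^\perp$ is the $g$-orthogonal complement of $T(\mathcal S)$, so $TM=T(\mathcal S)\oplus\mathcal N$, and $v$ is regarded as a $(1,1)$-tensor field (an endomorphism of $TM$ with image $T(\mathcal S)$ and kernel $\mathcal N$). The Nijenhuis torsion of a $(1,1)$-tensor field $J$ is $$N_J(\xi,\eta)=[J\xi,J\eta]-J[J\xi,\eta]-J[\xi,J\eta]+J^2[\xi,\eta]$$ for vector fields $\xi,\eta$. Summation over repeated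 indices is understood. *)

theory Defs
  imports "HOL-Analysis.Analysis"
begin

section \<open>Smooth maps between Euclidean spaces\<close>

text \<open>Intended for open \<open>U\<close>; derivatives are taken \<open>at x\<close>, not \<open>at x within U\<close>.\<close>

primrec k_smooth_on :: "nat \<Rightarrow> 'a::real_normed_vector set \<Rightarrow> ('a \<Rightarrow> 'b::real_normed_vector) \<Rightarrow> bool"
where
  "k_smooth_on 0 U f \<longleftrightarrow> continuous_on U f"
| "k_smooth_on (Suc r) U f \<longleftrightarrow>
     (\<forall>x\<in>U. f differentiable (at x)) \<and>
     (\<forall>u. k_smooth_on r U (\<lambda>x. frechet_derivative f (at x) u))"

definition smooth_map_on :: "'a::real_normed_vector set \<Rightarrow> ('a \<Rightarrow> 'b::real_normed_vector) \<Rightarrow> bool"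
  where "smooth_map_on U f \<longleftrightarrow> (\<forall>r. k_smooth_on r U f)"


section \<open>Smooth manifolds\<close>

text \<open>
  The points of the manifold \<open>M\<close> are the elements of a Hausdorff, second countable type \<open>'m\<close>;
  its dimension is \<open>n = CARD('n)\<close>. A chart is an open set together with a coordinate map. The
  values of the coordinate map outside this set carry no meaning.
\<close>

type_synonym ('m, 'n) chart = "'m set \<times> ('m \<Rightarrow> real ^ 'n)"

abbreviation chart_dom :: "('m, 'n) chart \<Rightarrow> 'm set"
  where "chart_dom \<equiv> fst"

abbreviation chart_map :: "('m, 'n) chart \<Rightarrow> 'm \<Rightarrow> real ^ 'n"
  where "chart_map \<equiv> snd"

definition chart_inv :: "('m, 'n) chart \<Rightarrow> real ^ 'n \<Rightarrow> 'm"
  where "chart_inv c = inv_into (chart_dom c) (chart_map c)"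

definition is_chart :: "('m::topological_space, 'n::finite) chart \<Rightarrow> bool"
  where "is_chart c \<longleftrightarrow>
    open (chart_dom c) \<and> open (chart_map c ` chart_dom c) \<and>
    homeomorphism (chart_dom c) (chart_map c ` chart_dom c) (chart_map c) (chart_inv c)"

definition transition :: "('m, 'n) chart \<Rightarrow> ('m, 'n) chart \<Rightarrow> real ^ 'n \<Rightarrow> real ^ 'n"
  where "transition c c' = chart_map c' \<circ> chart_inv c"

text \<open>The atlas need not be maximal: tensor fields given in the charts of an atlas extend uniquely
  to all charts compatible with it.\<close>

definition smooth_atlas :: "('m::{t2_space, second_countable_topology}, 'n::finite) chart set \<Rightarrow> bool"
  where "smooth_atlas \<A> \<longleftrightarrow>
    (\<forall>c\<in>\<A>. is_chart c) \<and> (\<Union>c\<in>\<A>. chart_dom c) = UNIV \<and>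
    (\<forall>c\<in>\<A>. \<forall>c'\<in>\<A>. smooth_map_on (chart_map c ` (chart_dom c \<inter> chart_dom c')) (transition c c'))"


section \<open>Tensor fields\<close>

text \<open>
  A field is the family of its components: \<open>T c p\<close> is the array of components at \<open>p\<close> in the chart
  \<open>c\<close>, which carries no meaning unless \<open>c\<close> belongs to the atlas and \<open>p\<close> to its domain. In a matrix
  \<open>T c p\<close> the first index is the row index, so that \<open>P c p ** g c p\<close> has the components
  \<open>P\<^sup>\<tau>\<^sup>\<sigma> g\<^sub>\<sigma>\<^sub>\<mu>\<close> and \<open>T c p *v u\<close> the components \<open>T\<^sup>\<tau>\<^sub>\<mu> u\<^sup>\<mu>\<close>.
\<close>

type_synonym ('m, 'n) vec_comps = "('m, 'n) chart \<Rightarrow> 'm \<Rightarrow> real ^ 'n"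
type_synonym ('m, 'n) mat_comps = "('m, 'n) chart \<Rightarrow> 'm \<Rightarrow> real ^ 'n ^ 'n"

definition smooth_comps ::
  "('m, 'n::finite) chart set \<Rightarrow> (('m, 'n) chart \<Rightarrow> 'm \<Rightarrow> 'b::real_normed_vector) \<Rightarrow> bool"
  where "smooth_comps \<A> T \<longleftrightarrow>
    (\<forall>c\<in>\<A>. smooth_map_on (chart_map c ` chart_dom c) (\<lambda>x. T c (chart_inv c x)))"

definition trans_jacobian :: "('m, 'n::finite) chart \<Rightarrow> ('m, 'n) chart \<Rightarrow> 'm \<Rightarrow> real ^ 'n ^ 'n"
  where "trans_jacobian c c' p = jacobian (transition c c') (at (chart_map c p))"

definition vector_field :: "('m, 'n::finite) chart set \<Rightarrow> ('m, 'n) vec_comps \<Rightarrow> bool"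
  where "vector_field \<A> \<xi> \<longleftrightarrow> smooth_comps \<A> \<xi> \<and>
    (\<forall>c\<in>\<A>. \<forall>c'\<in>\<A>. \<forall>p \<in> chart_dom c \<inter> chart_dom c'.
       \<xi> c' p = trans_jacobian c c' p *v \<xi> c p)"

definition tensor_field_20 :: "('m, 'n::finite) chart set \<Rightarrow> ('m, 'n) mat_comps \<Rightarrow> bool"
  where "tensor_field_20 \<A> T \<longleftrightarrow> smooth_comps \<A> T \<and>
    (\<forall>c\<in>\<A>. \<forall>c'\<in>\<A>. \<forall>p \<in> chart_dom c \<inter> chart_dom c'.
       T c' p = trans_jacobian c c' p ** T c p ** transpose (trans_jacobian c c' p))"

definition tensor_field_02 :: "('m, 'n::finite) chart set \<Rightarrow> ('m, 'n) mat_comps \<Rightarrow> bool"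
  where "tensor_field_02 \<A> T \<longleftrightarrow> smooth_comps \<A> T \<and>
    (\<forall>c\<in>\<A>. \<forall>c'\<in>\<A>. \<forall>p \<in> chart_dom c \<inter> chart_dom c'.
       T c p = transpose (trans_jacobian c c' p) ** T c' p ** trans_jacobian c c' p)"

definition tensor_field_11 :: "('m, 'n::finite) chart set \<Rightarrow> ('m, 'n) mat_comps \<Rightarrow> bool"
  where "tensor_field_11 \<A> T \<longleftrightarrow> smooth_comps \<A> T \<and>
    (\<forall>c\<in>\<A>. \<forall>c'\<in>\<A>. \<forall>p \<in> chart_dom c \<inter> chart_dom c'.
       T c' p ** trans_jacobian c c' p = trans_jacobian c c' p ** T c p)"

text \<open>Invertible linear automorphisms of \<open>TM\<close> over the identity of \<open>M\<close>.\<close>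

definition tangent_automorphism :: "('m, 'n::finite) chart set \<Rightarrow> ('m, 'n) mat_comps \<Rightarrow> bool"
  where "tangent_automorphism \<A> D \<longleftrightarrow>
    tensor_field_11 \<A> D \<and> (\<forall>c\<in>\<A>. \<forall>p\<in>chart_dom c. invertible (D c p))"

definition apply_11 :: "('m, 'n::finite) mat_comps \<Rightarrow> ('m, 'n) vec_comps \<Rightarrow> ('m, 'n) vec_comps"
  where "apply_11 T \<xi> = (\<lambda>c p. T c p *v \<xi> c p)"

definition partial_deriv ::
  "(('m, 'n::finite) chart \<Rightarrow> 'm \<Rightarrow> 'b::real_normed_vector) \<Rightarrow> ('m, 'n) chart \<Rightarrow> 'n \<Rightarrow> 'm \<Rightarrow> 'b"
  where "partial_deriv T c s p =
    frechet_derivative (\<lambda>x. T c (chart_inv c x)) (at (chart_map c p)) (axis s 1)"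

definition lie_bracket :: "('m, 'n::finite) vec_comps \<Rightarrow> ('m, 'n) vec_comps \<Rightarrow> ('m, 'n) vec_comps"
  where "lie_bracket \<xi> \<eta> = (\<lambda>c p. \<Sum>s\<in>UNIV.
    (\<xi> c p $ s) *\<^sub>R partial_deriv \<eta> c s p - (\<eta> c p $ s) *\<^sub>R partial_deriv \<xi> c s p)"

definition nijenhuis_torsion ::
  "('m, 'n::finite) mat_comps \<Rightarrow> ('m, 'n) vec_comps \<Rightarrow> ('m, 'n) vec_comps \<Rightarrow> ('m, 'n) vec_comps"
  where "nijenhuis_torsion J \<xi> \<eta> = (\<lambda>c p.
    lie_bracket (apply_11 J \<xi>) (apply_11 J \<eta>) c p
    - apply_11 J (lie_bracket (apply_11 J \<xi>) \<eta>) c p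
    - apply_11 J (lie_bracket \<xi> (apply_11 J \<eta>)) c p
    + apply_11 J (apply_11 J (lie_bracket \<xi> \<eta>)) c p)"


section \<open>Poisson structures and metrics\<close>

text \<open>The last clause is the vanishing of the Schouten bracket \<open>[P, P]\<close> in coordinates, that is, the
  Jacobi identity for the bracket of functions \<open>{f, h} = P\<^sup>\<tau>\<^sup>\<sigma> \<partial>\<^sub>\<tau>f \<partial>\<^sub>\<sigma>h\<close>.\<close>

definition poisson_bivector :: "('m, 'n::finite) chart set \<Rightarrow> ('m, 'n) mat_comps \<Rightarrow> bool"
  where "poisson_bivector \<A> P \<longleftrightarrow>
    tensor_field_20 \<A> P \<and>
    (\<forall>c\<in>\<A>. \<forall>p\<in>chart_dom c. transpose (P c p) = - P c p) \<and>
    (\<forall>c\<in>\<A>. \<forall>p\<in>chart_dom c. \<forall>i j l. (\<Sum>s\<in>UNIV.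
        P c p $ i $ s * partial_deriv P c s p $ j $ l
      + P c p $ j $ s * partial_deriv P c s p $ l $ i
      + P c p $ l $ s * partial_deriv P c s p $ i $ j) = 0)"

definition constant_rank :: "('m, 'n::finite) chart set \<Rightarrow> ('m, 'n) mat_comps \<Rightarrow> nat \<Rightarrow> bool"
  where "constant_rank \<A> P k \<longleftrightarrow> (\<forall>c\<in>\<A>. \<forall>p\<in>chart_dom c. rank (P c p) = k)"

definition pseudo_riemannian_metric :: "('m, 'n::finite) chart set \<Rightarrow> ('m, 'n) mat_comps \<Rightarrow> bool"
  where "pseudo_riemannian_metric \<A> g \<longleftrightarrow>
    tensor_field_02 \<A> g \<and>
    (\<forall>c\<in>\<A>. \<forall>p\<in>chart_dom c. transpose (g c p) = g c p \<and> invertible (g c p))"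

text \<open>\<open>T(\<S>)\<close> at \<open>p\<close>: the image of \<open>P : T\<^sup>*M \<rightarrow> TM\<close>, in components.\<close>

definition leaf_tangent :: "('m, 'n::finite) mat_comps \<Rightarrow> ('m, 'n) chart \<Rightarrow> 'm \<Rightarrow> (real ^ 'n) set"
  where "leaf_tangent P c p = range (\<lambda>\<alpha>. P c p *v \<alpha>)"

text \<open>
  The symplectic leaf through \<open>p\<close> consists of the endpoints of the curves that start at \<open>p\<close> and are
  everywhere tangent to \<open>T(\<S>)\<close>; its tangent space at each of its points is \<open>leaf_tangent\<close>.
\<close>

definition leaf_curve ::
  "('m::topological_space, 'n::finite) chart set \<Rightarrow> ('m, 'n) mat_comps \<Rightarrow> (real \<Rightarrow> 'm) \<Rightarrow> bool"
  where "leaf_curve \<A> P \<gamma> \<longleftrightarrow> continuous_on {0..1} \<gamma> \<and>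
    (\<forall>c\<in>\<A>. \<forall>t\<in>{0..1}. \<gamma> t \<in> chart_dom c \<longrightarrow>
       (\<exists>u\<in>leaf_tangent P c (\<gamma> t).
          ((\<lambda>s. chart_map c (\<gamma> s)) has_vector_derivative u) (at t within {0..1})))"

definition symplectic_leaves ::
  "('m::topological_space, 'n::finite) chart set \<Rightarrow> ('m, 'n) mat_comps \<Rightarrow> 'm set set"
  where "symplectic_leaves \<A> P = range (\<lambda>p. {q. \<exists>\<gamma>. leaf_curve \<A> P \<gamma> \<and> \<gamma> 0 = p \<and> \<gamma> 1 = q})"

definition nondegenerate_on_leaf ::
  "('m, 'n::finite) chart set \<Rightarrow> ('m, 'n) mat_comps \<Rightarrow> ('m, 'n) mat_comps \<Rightarrow> 'm set \<Rightarrow> bool"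
  where "nondegenerate_on_leaf \<A> P g S \<longleftrightarrow>
    (\<forall>p\<in>S. \<forall>c\<in>\<A>. p \<in> chart_dom c \<longrightarrow>
       (\<forall>u\<in>leaf_tangent P c p. (\<forall>w\<in>leaf_tangent P c p. u \<bullet> (g c p *v w) = 0) \<longrightarrow> u = 0))"

text \<open>\<open>\<N>\<close> at \<open>p\<close>.\<close>

definition normal_space ::
  "('m, 'n::finite) mat_comps \<Rightarrow> ('m, 'n) mat_comps \<Rightarrow> ('m, 'n) chart \<Rightarrow> 'm \<Rightarrow> (real ^ 'n) set"
  where "normal_space P g c p = {u. \<forall>w\<in>leaf_tangent P c p. u \<bullet> (g c p *v w) = 0}"

text \<open>\<open>\<Gamma>(\<N>)\<close>.\<close>

definition normal_sections ::
  "('m, 'n::finite) chart set \<Rightarrow> ('m, 'n) mat_comps \<Rightarrow> ('m, 'n) mat_comps \<Rightarrow> ('m, 'n) vec_comps set"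
  where "normal_sections \<A> P g =
    {\<xi>. vector_field \<A> \<xi> \<and> (\<forall>c\<in>\<A>. \<forall>p\<in>chart_dom c. \<xi> c p \<in> normal_space P g c p)}"

text \<open>The tensor \<open>A\<close> and the \<open>g\<close>-orthogonal projection \<open>v\<close> of \<open>TM\<close> onto \<open>T(\<S>)\<close>.\<close>

definition leaf_operator :: "('m, 'n::finite) mat_comps \<Rightarrow> ('m, 'n) mat_comps \<Rightarrow> ('m, 'n) mat_comps"
  where "leaf_operator P g = (\<lambda>c p. P c p ** g c p)"

definition leaf_projection :: "('m, 'n::finite) mat_comps \<Rightarrow> ('m, 'n) mat_comps \<Rightarrow> ('m, 'n) mat_comps"
  where "leaf_projection P g = (\<lambda>c p.
    (THE V. \<forall>u. V *v u \<in> leaf_tangent P c p \<and> u - V *v u \<in> normal_space P g c p))"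

text \<open>Equality of fields on \<open>M\<close>.\<close>

definition fields_eq ::
  "('m, 'n) chart set \<Rightarrow> (('m, 'n) chart \<Rightarrow> 'm \<Rightarrow> 'b) \<Rightarrow> (('m, 'n) chart \<Rightarrow> 'm \<Rightarrow> 'b) \<Rightarrow> bool"
  where "fields_eq \<A> X Y \<longleftrightarrow> (\<forall>c\<in>\<A>. \<forall>p\<in>chart_dom c. X c p = Y c p)"

text \<open>\<open>A[\<xi>, \<eta>] = D(N\<^sub>v(\<xi>, \<eta>))\<close> for all \<open>\<xi>, \<eta> \<in> \<Gamma>(\<N>)\<close>.\<close>

definition bracket_from_torsion ::
  "('m, 'n::finite) chart set \<Rightarrow> ('m, 'n) mat_comps \<Rightarrow> ('m, 'n) mat_comps \<Rightarrow>
   ('m, 'n) mat_comps \<Rightarrow> ('m, 'n) mat_comps \<Rightarrow> ('m, 'n) mat_comps \<Rightarrow> bool"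
  where "bracket_from_torsion \<A> P g A v D \<longleftrightarrow>
    (\<forall>\<xi>\<in>normal_sections \<A> P g. \<forall>\<eta>\<in>normal_sections \<A> P g.
       fields_eq \<A> (apply_11 A (lie_bracket \<xi> \<eta>)) (apply_11 D (nijenhuis_torsion v \<xi> \<eta>)))"

end

theory Submission
  imports Defs
begin

text \<open>
  On \<open>\<Gamma>(\<N>)\<close> the field \<open>v\<close> vanishes, so that \<open>N\<^sub>v(\<xi>, \<eta>) = v[\<xi>, \<eta>]\<close>. Since \<open>\<N> = ker A\<close> and \<open>A\<close> maps
  \<open>T(\<S>)\<close> bijectively onto itself, \<open>D = A + t (1 - v)\<close> is invertible for each \<open>t \<noteq> 0\<close>, and
  \<open>D v = A v = A\<close>. Smoothness of \<open>v\<close> is a local question: with \<open>v\<^sub>0 = v(x\<^sub>0)\<close> frozen in a chart, the matrix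
  \<open>G = v\<^sub>0 A\<^sup>2 v\<^sub>0 + (1 - v\<^sub>0)\<close> is invertible near \<open>x\<^sub>0\<close>, and constancy of the rank gives
  \<open>v = A v\<^sub>0 G\<^sup>-\<^sup>1 v\<^sub>0 A\<close> there.
\<close>

section \<open>Calculus of smooth maps\<close>

lemma k_smooth_on_subset:
  "k_smooth_on r U f \<Longrightarrow> V \<subseteq> U \<Longrightarrow> k_smooth_on r V f"
  by (induction r arbitrary: f) (auto intro: continuous_on_subset)

lemma k_smooth_on_SucD: "k_smooth_on (Suc r) U f \<Longrightarrow> k_smooth_on r U f"
proof (induction r arbitrary: f)
  case 0
  then show ?case
    by (auto intro!: continuous_at_imp_continuous_on differentiable_imp_continuous_within)
next
  case (Suc r)
  have "k_smooth_on r U (\<lambda>x. frechet_derivative f (at x) u)" for u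
    by (rule Suc.IH) (use Suc.prems k_smooth_on.simps(2)[of "Suc r"] in blast)
  then show ?case using Suc.prems by auto
qed

lemma k_smooth_on_imp_continuous_on: "k_smooth_on r U f \<Longrightarrow> continuous_on U f"
proof (induction r)
  case (Suc r)
  then show ?case using k_smooth_on_SucD by blast
qed simp

text \<open>Derivatives are taken in the ambient space, so agreement on \<open>U\<close> determines
  them because \<open>U\<close> is a neighbourhood of each of its points.\<close>

lemma k_smooth_on_cong:
  assumes "open U" and "\<And>x. x \<in> U \<Longrightarrow> f x = g x" and "k_smooth_on r U f"
  shows "k_smooth_on r U g"
  using assms(2,3)
proof (induction r arbitrary: f g)
  case 0
  then have "continuous_on U f" by simp
  then have "continuous_on U g" by (rule continuous_on_eq) (rule 0)
  then show ?case by simp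
next
  case (Suc r)
  have d: "(g has_derivative frechet_derivative f (at x)) (at x)" if "x \<in> U" for x
    using Suc.prems that assms(1)
    by (metis frechet_derivative_works has_derivative_transform_within_open k_smooth_on.simps(2))
  then have "frechet_derivative f (at x) u = frechet_derivative g (at x) u" if "x \<in> U" for x u
    using frechet_derivative_at that by metis
  then have "k_smooth_on r U (\<lambda>x. frechet_derivative g (at x) u)" for u
    using Suc.IH[of "\<lambda>x. frechet_derivative f (at x) u"] Suc.prems(2) by simp
  moreover have "g differentiable at x" if "x \<in> U" for x
    using d[OF that] differentiable_def by blast
  ultimately show ?case by simp
qed

text \<open>Each clause of the recursion is a condition at single points, since the derivatives and
  the continuity obtained on an open \<open>V\<close> do not refer to the surrounding set. This
  permits a different formula near each point.\<close>

lemma k_smooth_on_local: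
  assumes "\<And>x. x \<in> U \<Longrightarrow> \<exists>V. open V \<and> x \<in> V \<and> k_smooth_on r V f"
  shows "k_smooth_on r U f"
  using assms
proof (induction r arbitrary: f)
  case 0
  have "isCont f x" if "x \<in> U" for x
    using "0"[OF that] by (auto simp: continuous_on_eq_continuous_at)
  then show ?case by (simp add: continuous_at_imp_continuous_on)
next
  case (Suc r)
  have "k_smooth_on r U (\<lambda>x. frechet_derivative f (at x) u)" for u
    by (rule Suc.IH) (use Suc.prems in \<open>metis k_smooth_on.simps(2)\<close>)
  moreover have "f differentiable at x" if "x \<in> U" for x
    using Suc.prems[OF that] by auto
  ultimately show ?case by simp
qed

text \<open>Allows the inductions below to work with a derivative computed by the product or chain
  rule in place of \<open>frechet_derivative\<close>.\<close>

lemma k_smooth_on_SucI: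
  assumes "open U" and "\<And>x. x \<in> U \<Longrightarrow> (f has_derivative f' x) (at x)"
    and "\<And>u. k_smooth_on r U (\<lambda>x. f' x u)"
  shows "k_smooth_on (Suc r) U f"
proof -
  have "f' x = frechet_derivative f (at x)" if "x \<in> U" for x
    using assms(2)[OF that] by (rule frechet_derivative_at)
  then have "k_smooth_on r U (\<lambda>x. frechet_derivative f (at x) u)" for u
    by (intro k_smooth_on_cong[OF assms(1) _ assms(3)]) simp
  moreover have "f differentiable at x" if "x \<in> U" for x
    using assms(2)[OF that] unfolding differentiable_def by blast
  ultimately show ?thesis by simp
qed

lemma k_smooth_on_SucE:
  assumes "k_smooth_on (Suc r) U f"
  shows "\<And>x. x \<in> U \<Longrightarrow> (f has_derivative frechet_derivative f (at x)) (at x)"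
    and "\<And>u. k_smooth_on r U (\<lambda>x. frechet_derivative f (at x) u)"
  using assms frechet_derivative_works by auto

lemma k_smooth_on_const: "k_smooth_on r U (\<lambda>x. a)"
  by (induction r arbitrary: a) simp_all

lemma k_smooth_on_linear:
  assumes "open U" "bounded_linear h" "k_smooth_on r U f"
  shows "k_smooth_on r U (\<lambda>x. h (f x))"
  using assms(3)
proof (induction r arbitrary: f)
  case 0
  then show ?case using assms(2) by (simp add: bounded_linear.continuous_on)
next
  case (Suc r)
  note f = k_smooth_on_SucE[OF Suc.prems]
  show ?case
    by (rule k_smooth_on_SucI[OF assms(1) bounded_linear.has_derivative[OF assms(2) f(1)]])
      (use Suc.IH f(2) in auto)
qed

lemma k_smooth_on_add:
  assumes "open U" "k_smooth_on r U f" "k_smooth_on r U g"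
  shows "k_smooth_on r U (\<lambda>x. f x + g x)"
  using assms(2,3)
proof (induction r arbitrary: f g)
  case 0
  then show ?case by (simp add: continuous_on_add)
next
  case (Suc r)
  note f = k_smooth_on_SucE[OF Suc.prems(1)]
  note g = k_smooth_on_SucE[OF Suc.prems(2)]
  show ?case
    by (rule k_smooth_on_SucI[OF assms(1) has_derivative_add[OF f(1) g(1)]])
      (use Suc.IH f(2) g(2) in auto)
qed

lemma k_smooth_on_sum:
  assumes "open U" "\<And>i. i \<in> I \<Longrightarrow> k_smooth_on r U (f i)"
  shows "k_smooth_on r U (\<lambda>x. \<Sum>i\<in>I. f i x)"
  using assms(2)
  by (induction I rule: infinite_finite_induct)
    (simp_all add: k_smooth_on_const k_smooth_on_add assms(1))

text \<open>By the product rule the derivative is a sum of two terms \<open>h\<close>, each pairing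
  one factor with a derivative of the other. The induction hypothesis needs both at order
  \<open>r\<close>, so the undifferentiated factor is first lowered by one order.\<close>

lemma k_smooth_on_bilinear:
  assumes "open U" "bounded_bilinear h" "k_smooth_on r U f" "k_smooth_on r U g"
  shows "k_smooth_on r U (\<lambda>x. h (f x) (g x))"
  using assms(3,4)
proof (induction r arbitrary: f g)
  case 0
  then show ?case using assms(2) by (simp add: bounded_bilinear.continuous_on)
next
  case (Suc r)
  note f = k_smooth_on_SucE[OF Suc.prems(1)]
  note g = k_smooth_on_SucE[OF Suc.prems(2)]
  show ?case
    by (rule k_smooth_on_SucI[OF assms(1) bounded_bilinear.FDERIV[OF assms(2) f(1) g(1)]])
      (use Suc.IH f(2) g(2) Suc.prems[THEN k_smooth_on_SucD] in
        \<open>auto intro!: k_smooth_on_add[OF assms(1)]\<close>)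
qed

lemmas k_smooth_on_mult = k_smooth_on_bilinear[OF _ bounded_bilinear_mult]

lemma k_smooth_on_prod:
  fixes f :: "'i \<Rightarrow> 'a::real_normed_vector \<Rightarrow> real"
  assumes "open U" "\<And>i. i \<in> I \<Longrightarrow> k_smooth_on r U (f i)"
  shows "k_smooth_on r U (\<lambda>x. \<Prod>i\<in>I. f i x)"
  using assms(2)
  by (induction I rule: infinite_finite_induct)
    (simp_all add: k_smooth_on_const k_smooth_on_mult assms(1))

text \<open>The derivative of \<open>1/f\<close> again contains \<open>1/f\<close>, so the induction
  hypothesis for the same \<open>f\<close> supplies that factor at order \<open>r\<close>.\<close>

lemma k_smooth_on_inverse:
  fixes f :: "'a::real_normed_vector \<Rightarrow> real"
  assumes "open U" "k_smooth_on r U f" "\<And>x. x \<in> U \<Longrightarrow> f x \<noteq> 0"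
  shows "k_smooth_on r U (\<lambda>x. inverse (f x))"
  using assms(2)
proof (induction r)
  case 0
  then show ?case using assms(3) by (simp add: continuous_on_inverse)
next
  case (Suc r)
  note f = k_smooth_on_SucE[OF Suc.prems]
  have i: "k_smooth_on r U (\<lambda>x. inverse (f x))"
    using Suc k_smooth_on_SucD by blast
  show ?case
  proof (rule k_smooth_on_SucI[OF assms(1)])
    show "((\<lambda>x. inverse (f x)) has_derivative
        (\<lambda>u. - (inverse (f x) * frechet_derivative f (at x) u * inverse (f x)))) (at x)"
      if "x \<in> U" for x
      by (rule Deriv.has_derivative_inverse[OF assms(3) f(1)]) (rule that)+
    fix u
    have "k_smooth_on r U
        (\<lambda>x. inverse (f x) * frechet_derivative f (at x) u * inverse (f x))"
      by (intro k_smooth_on_mult assms(1) i f(2))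
    from k_smooth_on_linear[OF assms(1) bounded_linear_minus[OF bounded_linear_ident] this]
    show "k_smooth_on r U
        (\<lambda>x. - (inverse (f x) * frechet_derivative f (at x) u * inverse (f x)))" .
  qed
qed

section \<open>Smooth vector- and matrix-valued maps, determinants and inverses\<close>

lemma k_smooth_on_nth:
  fixes f :: "'a::real_normed_vector \<Rightarrow> 'b::real_normed_vector ^ 'n::finite"
  assumes "open U" "k_smooth_on r U f"
  shows "k_smooth_on r U (\<lambda>x. f x $ i)"
  using k_smooth_on_linear[OF assms(1) bounded_linear_vec_nth assms(2)] .

text \<open>Inclusion of the \<open>i\<close>-th summand; a vector is the sum of these images of its
  entries, which reduces its smoothness to that of the entries.\<close>

lemma bounded_linear_vec_single:
  "bounded_linear (\<lambda>y::'b::real_normed_vector. (\<chi> j. if j = i then y else 0) :: 'b ^ 'n::finite)"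
  by (rule bounded_linear_intro[where K = 1])
    (auto simp: vec_eq_iff norm_vec_def L2_set_def if_distrib[of norm] if_distrib[of "\<lambda>y. y ^ 2"]
      cong: if_cong)

lemma k_smooth_on_vec_lambda:
  fixes f :: "'n::finite \<Rightarrow> 'a::real_normed_vector \<Rightarrow> 'b::real_normed_vector"
  assumes "open U" "\<And>i. k_smooth_on r U (f i)"
  shows "k_smooth_on r U (\<lambda>x. \<chi> i. f i x)"
proof -
  have "(\<chi> i. f i x) = (\<Sum>i\<in>UNIV. \<chi> j. if j = i then f i x else 0)" for x
    by (simp add: vec_eq_iff)
  moreover have "k_smooth_on r U (\<lambda>x. \<Sum>i\<in>UNIV. (\<chi> j. if j = i then f i x else 0) :: 'b ^ 'n)"
    by (intro k_smooth_on_sum k_smooth_on_linear[OF _ bounded_linear_vec_single] assms)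
  ultimately show ?thesis by simp
qed

lemma k_smooth_on_matrix_mult:
  fixes f :: "'a::real_normed_vector \<Rightarrow> real ^ 'n::finite ^ 'l::finite"
    and g :: "'a \<Rightarrow> real ^ 'k::finite ^ 'n"
  assumes "open U" "k_smooth_on r U f" "k_smooth_on r U g"
  shows "k_smooth_on r U (\<lambda>x. f x ** g x)"
  unfolding matrix_matrix_mult_def
  by (intro k_smooth_on_vec_lambda k_smooth_on_sum k_smooth_on_mult k_smooth_on_nth assms)

lemma k_smooth_on_det:
  fixes f :: "'a::real_normed_vector \<Rightarrow> real ^ 'n::finite ^ 'n"
  assumes "open U" "k_smooth_on r U f"
  shows "k_smooth_on r U (\<lambda>x. det (f x))"
  unfolding det_def
  by (intro k_smooth_on_sum k_smooth_on_mult k_smooth_on_prod k_smooth_on_nth k_smooth_on_const assms)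

lemma invertible_matrix_inv:
  assumes "invertible A"
  shows "A ** matrix_inv A = mat 1" "matrix_inv A ** A = mat 1"
  using assms unfolding matrix_inv_def invertible_def by (metis (mono_tags, lifting) someI_ex)+

text \<open>Cramer's rule writes each entry of the inverse as a quotient of determinants, and
  determinants are polynomial in the entries.\<close>

lemma k_smooth_on_matrix_inv:
  fixes f :: "'a::real_normed_vector \<Rightarrow> real ^ 'n::finite ^ 'n"
  assumes "open U" "k_smooth_on r U f" "\<And>x. x \<in> U \<Longrightarrow> det (f x) \<noteq> 0"
  shows "k_smooth_on r U (\<lambda>x. matrix_inv (f x))"
proof (rule k_smooth_on_cong[OF assms(1)])
  \<comment> \<open>The matrix \<open>f x\<close> with column \<open>i\<close> replaced by the basis
    vector \<open>axis j 1\<close>.\<close>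
  let ?C = "\<lambda>x i j. \<chi> a b. if b = i then axis j 1 $ a else f x $ a $ b"
  show "(\<chi> i j. det (?C x i j) * inverse (det (f x))) = matrix_inv (f x)" if "x \<in> U" for x
  proof -
    have "f x *v (matrix_inv (f x) *v axis j 1) = axis j 1" for j
      using invertible_matrix_inv(1)[of "f x"] assms(3)[OF that]
      by (simp add: invertible_det_nz matrix_vector_mul_assoc)
    then have "matrix_inv (f x) *v axis j 1 = (\<chi> i. det (?C x i j) / det (f x))" for j
      using cramer[OF assms(3)[OF that]] by blast
    then have "matrix_inv (f x) $ i $ j = det (?C x i j) / det (f x)" for i j
      by (simp add: vec_eq_iff matrix_vector_mult_basis column_def)
    then show ?thesis by (simp add: vec_eq_iff divide_inverse)
  qed
  have "k_smooth_on r U (\<lambda>x. if b = i then axis j 1 $ a else f x $ a $ b)" for i j a b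
    by (cases "b = i") (simp_all add: k_smooth_on_const k_smooth_on_nth assms)
  then show "k_smooth_on r U (\<lambda>x. \<chi> i j. det (?C x i j) * inverse (det (f x)))"
    by (intro k_smooth_on_vec_lambda k_smooth_on_mult k_smooth_on_inverse k_smooth_on_det
        assms)
qed

section \<open>The projection onto the range along the kernel\<close>

text \<open>For \<open>A = P g\<close> the range is \<open>T(\<S>)\<close> and the kernel is the
  normal space, so this describes the orthogonal projection through \<open>A\<close> alone.\<close>

definition range_kernel_projection :: "real ^ 'n ^ 'n \<Rightarrow> real ^ 'n::finite ^ 'n \<Rightarrow> bool"
  where "range_kernel_projection A V \<longleftrightarrow>
    (\<forall>u. V *v u \<in> range ((*v) A) \<and> A *v (u - V *v u) = 0)"

text \<open>For \<open>A = P g\<close> this is nondegeneracy of the metric on the leaf: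
  \<open>T(\<S>)\<close> meets its orthogonal complement only in 0.\<close>

definition range_kernel_disjoint :: "real ^ 'n::finite ^ 'n \<Rightarrow> bool"
  where "range_kernel_disjoint A \<longleftrightarrow> (\<forall>w \<in> range ((*v) A). A *v w = 0 \<longrightarrow> w = 0)"

text \<open>Two candidates for the range component of \<open>u\<close> differ by a vector lying in
  both range and kernel.\<close>

lemma range_kernel_projection_unique:
  assumes "range_kernel_disjoint A" "range_kernel_projection A V"
    and "w \<in> range ((*v) A)" "A *v (u - w) = 0"
  shows "V *v u = w"
proof -
  obtain a where a: "V *v u = A *v a"
    using assms(2) unfolding range_kernel_projection_def by blast
  obtain b where b: "w = A *v b" using assms(3) by blast
  have "V *v u - w = A *v (a - b)"
    using a b by (simp add: matrix_vector_mult_diff_distrib)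
  moreover have "A *v (V *v u - w) = 0"
    using assms(2,4) unfolding range_kernel_projection_def
    by (simp add: matrix_vector_mult_diff_distrib)
  ultimately show ?thesis
    using assms(1) unfolding range_kernel_disjoint_def by (metis rangeI right_minus_eq)
qed

text \<open>Restricted to its range, \<open>A\<close> is injective, hence by dimension onto that
  range. So \<open>A u = A w\<close> for some \<open>w\<close> in the range.\<close>

lemma range_kernel_disjoint_surj:
  assumes "range_kernel_disjoint A"
  shows "\<exists>w \<in> range ((*v) A). A *v (u - w) = 0"
proof -
  let ?T = "range ((*v) A)"
  have T: "subspace ?T" by (simp add: linear_subspace_image)
  have "inj_on ((*v) A) (span ?T)"
    using assms unfolding range_kernel_disjoint_def
    by (metis T linear_inj_on_iff_eq_0 matrix_vector_mul_linear span_eq_iff subspace_span)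
  then have "dim ((*v) A ` ?T) = dim ?T" by (intro dim_image_eq) auto
  then have "(*v) A ` ?T = ?T"
    using T by (intro subspace_dim_equal) (auto simp: linear_subspace_image)
  then obtain w where "w \<in> ?T" "A *v u = A *v w" by (metis imageE rangeI)
  then show ?thesis by (auto simp: matrix_vector_mult_diff_distrib)
qed

text \<open>Choose a range component for every \<open>u\<close>; since the component is unique, the
  choice is automatically linear and thus given by a matrix.\<close>

lemma range_kernel_projection_exists:
  assumes "range_kernel_disjoint A"
  shows "\<exists>V. range_kernel_projection A V"
proof -
  obtain f where f: "\<And>u. f u \<in> range ((*v) A)" "\<And>u. A *v (u - f u) = 0"
    using range_kernel_disjoint_surj[OF assms] by metis
  have T: "subspace (range ((*v) A))" by (simp add: linear_subspace_image)
  have uniq: "f u = w" if "w \<in> range ((*v) A)" "A *v (u - w) = 0" for u w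
  proof -
    have "A *v (f u - w) = 0" using f(2)[of u] that(2) by (simp add: matrix_vector_mult_diff_distrib)
    moreover have "f u - w \<in> range ((*v) A)" using T f(1) that(1) by (rule subspace_diff)
    ultimately show ?thesis using assms unfolding range_kernel_disjoint_def by auto
  qed
  have "linear f"
  proof (rule linearI)
    fix u w
    show "f (u + w) = f u + f w"
      using f(2)[of u] f(2)[of w]
      by (intro uniq subspace_add[OF T] f(1))
        (simp add: matrix_vector_mult_diff_distrib matrix_vector_right_distrib)
  next
    fix t u
    show "f (t *\<^sub>R u) = t *\<^sub>R f u"
      using f(2)[of u]
      by (intro uniq subspace_scale[OF T] f(1))
        (simp add: matrix_vector_mult_diff_distrib matrix_vector_mult_scaleR)
  qed
  then show ?thesis
    using f unfolding range_kernel_projection_def by (intro exI[of _ "matrix f"]) simp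
qed

context
  fixes A V :: "real ^ 'n::finite ^ 'n"
  assumes disj: "range_kernel_disjoint A" and proj: "range_kernel_projection A V"
begin

lemma projection_of_range: "w \<in> range ((*v) A) \<Longrightarrow> V *v w = w"
  by (rule range_kernel_projection_unique[OF disj proj]) auto

lemma projection_of_kernel: "A *v u = 0 \<Longrightarrow> V *v u = 0"
  by (rule range_kernel_projection_unique[OF disj proj]) (auto intro: image_eqI[of _ _ 0])

lemma projection_in_range: "V *v u \<in> range ((*v) A)"
  using proj unfolding range_kernel_projection_def by blast

lemma mult_projection: "A *v (V *v u) = A *v u"
  using proj unfolding range_kernel_projection_def by (simp add: matrix_vector_mult_diff_distrib)

lemma projection_mult: "V *v (A *v u) = A *v u"
  using projection_of_range by blast

lemma projection_idem: "V *v (V *v u) = V *v u"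
  using projection_of_range projection_in_range by blast

lemma range_projection: "range ((*v) V) = range ((*v) A)"
proof
  show "range ((*v) V) \<subseteq> range ((*v) A)" using projection_in_range by blast
  show "range ((*v) A) \<subseteq> range ((*v) V)" by (metis image_subsetI projection_mult rangeI)
qed

lemma rank_projection: "rank V = rank A"
  using range_projection by (simp add: rank_dim_range)

text \<open>The map is \<open>A\<close> on the range and multiplication by \<open>t\<close> on the
  kernel. Applying \<open>V\<close> to a vanishing image removes the second summand and leaves
  \<open>A u = 0\<close>, after which only \<open>t u = 0\<close> remains.\<close>

lemma invertible_deformation:
  assumes "t \<noteq> 0"
  shows "invertible (A + t *\<^sub>R (mat 1 - V))"
proof -
  have "u = 0" if 0: "(A + t *\<^sub>R (mat 1 - V)) *v u = 0" for u
  proof -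
    have e: "A *v u + t *\<^sub>R (u - V *v u) = 0"
      using 0 by (simp add: matrix_vector_mult_add_rdistrib matrix_vector_mult_diff_rdistrib
          scaleR_matrix_vector_assoc[symmetric])
    then have "V *v (A *v u + t *\<^sub>R (u - V *v u)) = 0" by simp
    then have "A *v u = 0"
      by (simp add: matrix_vector_right_distrib matrix_vector_mult_scaleR
          matrix_vector_mult_diff_distrib projection_idem projection_mult)
    with e assms projection_of_kernel show "u = 0" by simp
  qed
  then show ?thesis
    by (simp add: invertible_left_inverse matrix_left_invertible_ker)
qed

text \<open>This is \<open>G\<close> at the freezing point itself, where it acts as the square of
  \<open>A\<close> on the range and as the identity on the kernel. Continuity of the determinant
  later carries invertibility to nearby points.\<close>

lemma invertible_frozen_gram:
  "invertible (V ** A ** A ** V + (mat 1 - V))"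
proof -
  have "u = 0" if 0: "(V ** A ** A ** V + (mat 1 - V)) *v u = 0" for u
  proof -
    have e: "A *v (A *v u) + (u - V *v u) = 0"
      using 0 by (simp add: matrix_vector_mult_add_rdistrib matrix_vector_mult_diff_rdistrib
          matrix_vector_mul_assoc[symmetric] projection_mult mult_projection)
    then have "V *v (A *v (A *v u) + (u - V *v u)) = 0" by simp
    then have "A *v (A *v u) = 0"
      by (simp add: matrix_vector_right_distrib
          matrix_vector_mult_diff_distrib projection_idem projection_mult)
    then have "A *v u = 0" using disj unfolding range_kernel_disjoint_def by blast
    with e projection_of_kernel show "u = 0" by simp
  qed
  then show ?thesis
    by (simp add: invertible_left_inverse matrix_left_invertible_ker)
qed

text \<open>Here \<open>V0\<close> is the projection frozen at a nearby point. Equality of ranks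
  forces \<open>A V0\<close> to have the full range of \<open>A\<close>, and on vectors
  \<open>A V0 u\<close> the proposed matrix is seen to be the identity.\<close>

lemma projection_formula:
  fixes V0 G :: "real ^ 'n ^ 'n"
  assumes idem: "\<And>u. V0 *v (V0 *v u) = V0 *v u" and rk: "rank V0 = rank A"
    and G_def: "G = V0 ** A ** A ** V0 + (mat 1 - V0)" and inv: "invertible G"
  shows "V = A ** V0 ** matrix_inv G ** V0 ** A"
proof -
  have G: "G *v u = V0 *v (A *v (A *v (V0 *v u))) + (u - V0 *v u)" for u
    unfolding G_def
    by (simp add: matrix_vector_mult_add_rdistrib matrix_vector_mult_diff_rdistrib
        matrix_vector_mul_assoc[symmetric])
  have GV: "G *v (V0 *v u) = V0 *v (A *v (A *v (V0 *v u)))" for u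
    by (simp add: G idem)
  have VG: "V0 *v (G *v u) = V0 *v (A *v (A *v (V0 *v u)))" for u
    by (simp add: G idem matrix_vector_right_distrib matrix_vector_mult_diff_distrib)
  have Gi: "matrix_inv G *v (G *v u) = u" "G *v (matrix_inv G *v u) = u" for u
    using invertible_matrix_inv[OF inv] by (simp_all add: matrix_vector_mul_assoc)
  let ?X = "A ** V0"
  \<comment> \<open>\<open>V0 G = V0 A A V0\<close> with \<open>G\<close> onto, so every
    \<open>V0 w\<close> has the form \<open>V0 A A V0 u\<close>. This bounds the rank of
    \<open>A V0\<close> from below by that of \<open>V0\<close>.\<close>
  have "range ((*v) V0) \<subseteq> range ((*v) (V0 ** A ** ?X))"
    by (clarsimp simp: matrix_vector_mul_assoc[symmetric] image_iff)
      (metis VG Gi(2))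
  then have "rank V0 \<le> rank (V0 ** A ** ?X)"
    by (simp add: rank_dim_range dim_subset)
  also have "\<dots> \<le> rank ?X" by (rule rank_mul_le_right)
  finally have "dim (range ((*v) A)) \<le> dim (range ((*v) ?X))"
    using rk by (simp add: rank_dim_range)
  then have rX: "range ((*v) ?X) = range ((*v) A)"
    by (intro subspace_dim_equal linear_subspace_image matrix_vector_mul_linear subspace_UNIV)
      (auto simp: matrix_vector_mul_assoc[symmetric])
  have B: "(A ** V0 ** matrix_inv G ** V0 ** A) *v u = A *v (V0 *v (matrix_inv G *v (V0 *v (A *v u))))"
    for u by (simp add: matrix_vector_mul_assoc[symmetric])
  \<comment> \<open>For \<open>w = A V0 u\<close> one has \<open>V0 A w = G V0 u\<close>, so
    \<open>matrix_inv G\<close> returns \<open>V0 u\<close> and \<open>A V0\<close> returns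
    \<open>w\<close>.\<close>
  have "A *v (V0 *v (matrix_inv G *v (V0 *v (A *v w)))) = w" if "w \<in> range ((*v) A)" for w
  proof -
    from that obtain u where "w = ?X *v u" unfolding rX[symmetric] by blast
    then have "w = A *v (V0 *v u)" by (simp add: matrix_vector_mul_assoc)
    then show ?thesis by (metis GV Gi(1) idem)
  qed
  \<comment> \<open>The formula begins by applying \<open>A\<close>, and \<open>A V u = A u\<close>;
    so \<open>u\<close> may be replaced by \<open>V u\<close>, a vector of the range, which is
    fixed.\<close>
  then have "V *v u = (A ** V0 ** matrix_inv G ** V0 ** A) *v u" for u
    unfolding B using projection_in_range mult_projection by metis
  then show ?thesis by (simp add: matrix_eq)
qed

end

section \<open>Smooth dependence of the projection on a matrix of constant rank\<close>

lemma k_smooth_on_projection: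
  fixes A V :: "'a::real_normed_vector \<Rightarrow> real ^ 'n::finite ^ 'n"
  assumes U: "open U" and A: "k_smooth_on r U A"
    and disj: "\<And>x. x \<in> U \<Longrightarrow> range_kernel_disjoint (A x)"
    and proj: "\<And>x. x \<in> U \<Longrightarrow> range_kernel_projection (A x) (V x)"
    and rank: "\<And>x. x \<in> U \<Longrightarrow> rank (A x) = k"
  shows "k_smooth_on r U V"
proof (rule k_smooth_on_local)
  fix x0
  assume x0: "x0 \<in> U"
  \<comment> \<open>Only the constant matrix \<open>V x0\<close> occurs, so \<open>G\<close>
    inherits smoothness from \<open>A\<close> while nothing is yet known about the regularity of
    \<open>V\<close>.\<close>
  define G where "G x = V x0 ** A x ** A x ** V x0 + (mat 1 - V x0)" for x
  define W where "W = U \<inter> (\<lambda>x. det (G x)) -` (- {0})"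
  have G: "k_smooth_on r U G"
    unfolding G_def
    by (intro k_smooth_on_add k_smooth_on_matrix_mult k_smooth_on_const U A)
  have W: "open W" "W \<subseteq> U"
    unfolding W_def
    using U
    by (intro continuous_open_preimage
        k_smooth_on_imp_continuous_on[OF k_smooth_on_det[OF U G]]) auto
  have "x0 \<in> W"
    using invertible_frozen_gram[OF disj[OF x0] proj[OF x0]] x0
    by (simp add: W_def G_def invertible_det_nz)
  moreover have "k_smooth_on r W V"
  proof (rule k_smooth_on_cong[OF W(1)])
    show "A x ** V x0 ** matrix_inv (G x) ** V x0 ** A x = V x" if "x \<in> W" for x
    proof (rule projection_formula[symmetric])
      show "range_kernel_disjoint (A x)" "range_kernel_projection (A x) (V x)"
        using that W(2) disj proj by auto
      show "V x0 *v (V x0 *v u) = V x0 *v u" for u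
        using projection_idem[OF disj proj] x0 by blast
      show "rank (V x0) = rank (A x)"
        using rank_projection[OF disj[OF x0] proj[OF x0]] rank that x0 W(2) by auto
      show "invertible (G x)"
        using that by (simp add: W_def invertible_det_nz)
    qed (simp add: G_def)
    have "k_smooth_on r W A" "k_smooth_on r W G"
      using A G W(2) k_smooth_on_subset by blast+
    then show "k_smooth_on r W (\<lambda>x. A x ** V x0 ** matrix_inv (G x) ** V x0 ** A x)"
      by (intro k_smooth_on_matrix_mult k_smooth_on_matrix_inv k_smooth_on_const W(1))
        (auto simp: W_def)
  qed
  ultimately show "\<exists>W. open W \<and> x0 \<in> W \<and> k_smooth_on r W V"
    using W(1) by blast
qed

section \<open>Fields on the manifold\<close>

lemma smooth_compsI:
  assumes "\<And>c r. c \<in> \<A> \<Longrightarrow> k_smooth_on r (chart_map c ` chart_dom c) (\<lambda>x. T c (chart_inv c x))"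
  shows "smooth_comps \<A> T"
  using assms by (simp add: smooth_comps_def smooth_map_on_def)

lemma smooth_compsD:
  assumes "smooth_comps \<A> T" "c \<in> \<A>"
  shows "k_smooth_on r (chart_map c ` chart_dom c) (\<lambda>x. T c (chart_inv c x))"
  using assms by (simp add: smooth_comps_def smooth_map_on_def)

lemma open_chart_image: "is_chart c \<Longrightarrow> open (chart_map c ` chart_dom c)"
  by (simp add: is_chart_def)

lemma chart_inv_in_dom: "x \<in> chart_map c ` chart_dom c \<Longrightarrow> chart_inv c x \<in> chart_dom c"
  by (simp add: chart_inv_def inv_into_into)

lemma smooth_comps_projection:
  assumes "\<And>c. c \<in> \<A> \<Longrightarrow> is_chart c" and "smooth_comps \<A> A"
    and "\<And>c p. c \<in> \<A> \<Longrightarrow> p \<in> chart_dom c \<Longrightarrow> range_kernel_disjoint (A c p)"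
    and "\<And>c p. c \<in> \<A> \<Longrightarrow> p \<in> chart_dom c \<Longrightarrow> range_kernel_projection (A c p) (v c p)"
    and "\<And>c p. c \<in> \<A> \<Longrightarrow> p \<in> chart_dom c \<Longrightarrow> rank (A c p) = k"
  shows "smooth_comps \<A> v"
proof (rule smooth_compsI)
  fix c r
  assume c: "c \<in> \<A>"
  show "k_smooth_on r (chart_map c ` chart_dom c) (\<lambda>x. v c (chart_inv c x))"
    by (rule k_smooth_on_projection[OF open_chart_image[OF assms(1)[OF c]]
          smooth_compsD[OF assms(2) c] assms(3)[OF c chart_inv_in_dom]
          assms(4)[OF c chart_inv_in_dom] assms(5)[OF c chart_inv_in_dom]])
qed

text \<open>The Jacobian intertwines the two component matrices of \<open>A\<close>, hence carries
  range to range and kernel to kernel. Uniqueness of the range component gives the transformation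
  law of \<open>v\<close>.\<close>

lemma tensor_field_11_projection:
  assumes "\<And>c. c \<in> \<A> \<Longrightarrow> is_chart c" and A: "tensor_field_11 \<A> A"
    and disj: "\<And>c p. c \<in> \<A> \<Longrightarrow> p \<in> chart_dom c \<Longrightarrow> range_kernel_disjoint (A c p)"
    and proj: "\<And>c p. c \<in> \<A> \<Longrightarrow> p \<in> chart_dom c \<Longrightarrow> range_kernel_projection (A c p) (v c p)"
    and "\<And>c p. c \<in> \<A> \<Longrightarrow> p \<in> chart_dom c \<Longrightarrow> rank (A c p) = k"
  shows "tensor_field_11 \<A> v"
  unfolding tensor_field_11_def
proof (intro conjI ballI)
  show "smooth_comps \<A> v"
    using A
    by (intro smooth_comps_projection[OF assms(1) _ disj proj assms(5)])
      (simp_all add: tensor_field_11_def)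
next
  fix c c' p
  assume c: "c \<in> \<A>" "c' \<in> \<A>" and p: "p \<in> chart_dom c \<inter> chart_dom c'"
  let ?J = "trans_jacobian c c' p"
  have "A c' p ** ?J = ?J ** A c p"
    using A c p unfolding tensor_field_11_def by blast
  then have J: "A c' p *v (?J *v u) = ?J *v (A c p *v u)" for u
    by (simp add: matrix_vector_mul_assoc)
  have "v c' p *v (?J *v u) = ?J *v (v c p *v u)" for u
  proof (rule range_kernel_projection_unique[OF disj[OF c(2)] proj[OF c(2)]])
    show "?J *v (v c p *v u) \<in> range ((*v) (A c' p))"
      using projection_in_range[OF disj proj, of c p u] c p by (auto simp flip: J)
    show "A c' p *v (?J *v u - ?J *v (v c p *v u)) = 0"
      using mult_projection[OF disj proj, of c p u] c p
      by (simp add: matrix_vector_mult_diff_distrib J)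
  qed (use p in auto)
  then show "v c' p ** ?J = ?J ** v c p"
    by (simp add: matrix_eq flip: matrix_vector_mul_assoc)
qed

lemma tensor_field_11_deformation:
  assumes chart: "\<And>c. c \<in> \<A> \<Longrightarrow> is_chart c"
    and A: "tensor_field_11 \<A> A" and v: "tensor_field_11 \<A> v"
  shows "tensor_field_11 \<A> (\<lambda>c p. A c p + t *\<^sub>R (mat 1 - v c p))"
  unfolding tensor_field_11_def
proof (intro conjI ballI smooth_compsI)
  fix c r
  assume c: "c \<in> \<A>"
  have lin: "bounded_linear (\<lambda>M :: real ^ 'b ^ 'b. t *\<^sub>R (- M))"
    by (intro bounded_linear_scaleR_right[THEN bounded_linear_compose] bounded_linear_minus
        bounded_linear_ident)
  have "k_smooth_on r (chart_map c ` chart_dom c) (\<lambda>x. A c (chart_inv c x)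
      + (t *\<^sub>R mat 1 + t *\<^sub>R (- v c (chart_inv c x))))"
    using A v c unfolding tensor_field_11_def
    by (intro k_smooth_on_add k_smooth_on_const k_smooth_on_linear[OF _ lin] smooth_compsD
        open_chart_image chart) auto
  then show "k_smooth_on r (chart_map c ` chart_dom c)
      (\<lambda>x. A c (chart_inv c x) + t *\<^sub>R (mat 1 - v c (chart_inv c x)))"
    by (simp add: scaleR_diff_right)
next
  fix c c' p
  assume c: "c \<in> \<A>" "c' \<in> \<A>" and p: "p \<in> chart_dom c \<inter> chart_dom c'"
  let ?J = "trans_jacobian c c' p"
  have "A c' p ** ?J = ?J ** A c p" "v c' p ** ?J = ?J ** v c p"
    using A v c p unfolding tensor_field_11_def by blast+
  then have "A c' p *v (?J *v u) = ?J *v (A c p *v u)" "v c' p *v (?J *v u) = ?J *v (v c p *v u)"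
    for u by (simp_all add: matrix_vector_mul_assoc)
  then show "(A c' p + t *\<^sub>R (mat 1 - v c' p)) ** ?J = ?J ** (A c p + t *\<^sub>R (mat 1 - v c p))"
    by (simp add: matrix_eq matrix_vector_mult_add_rdistrib matrix_vector_mult_diff_rdistrib
        matrix_vector_right_distrib matrix_vector_mult_diff_distrib matrix_vector_mult_scaleR
        flip: matrix_vector_mul_assoc scaleR_matrix_vector_assoc)
qed

text \<open>The transposed Jacobian from \<open>P\<close> is absorbed by the metric:
  \<open>J P J^T g' J = J P g\<close>.\<close>

lemma tensor_field_11_leaf_operator:
  assumes chart: "\<And>c. c \<in> \<A> \<Longrightarrow> is_chart c"
    and P: "tensor_field_20 \<A> P" and g: "tensor_field_02 \<A> g"
  shows "tensor_field_11 \<A> (leaf_operator P g)"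
  unfolding tensor_field_11_def leaf_operator_def
proof (intro conjI ballI smooth_compsI)
  show "k_smooth_on r (chart_map c ` chart_dom c)
      (\<lambda>x. P c (chart_inv c x) ** g c (chart_inv c x))" if "c \<in> \<A>" for c r
    using P g that unfolding tensor_field_20_def tensor_field_02_def
    by (intro k_smooth_on_matrix_mult smooth_compsD open_chart_image chart) auto
next
  fix c c' p
  assume c: "c \<in> \<A>" "c' \<in> \<A>" and p: "p \<in> chart_dom c \<inter> chart_dom c'"
  let ?J = "trans_jacobian c c' p"
  have "P c' p = ?J ** P c p ** transpose ?J"
    using P c p unfolding tensor_field_20_def by blast
  moreover have "g c p = transpose ?J ** g c' p ** ?J"
    using g c p unfolding tensor_field_02_def by blast
  ultimately show "P c' p ** g c' p ** ?J = ?J ** (P c p ** g c p)"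
    by (simp add: matrix_mul_assoc)
qed

lemma partial_deriv_zero:
  assumes "is_chart c" "p \<in> chart_dom c" "\<And>q. q \<in> chart_dom c \<Longrightarrow> \<xi> c q = 0"
  shows "partial_deriv \<xi> c s p = 0"
proof -
  have "frechet_derivative (\<lambda>_. 0) (at (chart_map c p))
      = frechet_derivative (\<lambda>x. \<xi> c (chart_inv c x)) (at (chart_map c p))"
    using assms(2) assms(3)[OF chart_inv_in_dom]
    by (intro frechet_derivative_transform_within_open[OF _ open_chart_image[OF assms(1)]]) auto
  then show ?thesis by (metis frechet_derivative_const partial_deriv_def)
qed

text \<open>\<open>J \<xi>\<close> and \<open>J \<eta>\<close> vanish on the whole chart domain, so
  their derivatives vanish too. Three of the four brackets drop out.\<close>

lemma nijenhuis_torsion_of_kernel: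
  assumes "is_chart c" "p \<in> chart_dom c"
    and "\<And>q. q \<in> chart_dom c \<Longrightarrow> J c q *v \<xi> c q = 0"
    and "\<And>q. q \<in> chart_dom c \<Longrightarrow> J c q *v \<eta> c q = 0"
  shows "nijenhuis_torsion J \<xi> \<eta> c p = J c p *v (J c p *v lie_bracket \<xi> \<eta> c p)"
proof -
  have "partial_deriv (apply_11 J \<xi>) c s p = 0" "partial_deriv (apply_11 J \<eta>) c s p = 0" for s
    using assms by (auto intro!: partial_deriv_zero simp: apply_11_def)
  moreover have "apply_11 J \<xi> c p = 0" "apply_11 J \<eta> c p = 0"
    using assms by (auto simp: apply_11_def)
  ultimately have "lie_bracket (apply_11 J \<xi>) \<zeta> c p = 0" "lie_bracket \<zeta> (apply_11 J \<eta>) c p = 0"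
    if "\<zeta> \<in> {\<xi>, \<eta>, apply_11 J \<xi>, apply_11 J \<eta>}" for \<zeta>
    by (simp_all add: lie_bracket_def)
  then show ?thesis by (simp add: nijenhuis_torsion_def apply_11_def)
qed

section \<open>Poisson bivector and metric\<close>

text \<open>Every covector arises by lowering the index of a vector, namely of
  \<open>matrix_inv (g c p) *v \<alpha>\<close>.\<close>

lemma leaf_tangent_eq_range:
  assumes "invertible (g c p)"
  shows "leaf_tangent P c p = range ((*v) (leaf_operator P g c p))"
proof -
  have "P c p *v \<alpha> = leaf_operator P g c p *v (matrix_inv (g c p) *v \<alpha>)" for \<alpha>
    using invertible_matrix_inv(1)[OF assms]
    by (simp add: leaf_operator_def matrix_vector_mul_assoc flip: matrix_mul_assoc)
  then have "leaf_tangent P c p \<subseteq> range ((*v) (leaf_operator P g c p))"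
    by (auto simp: leaf_tangent_def)
  moreover have "range ((*v) (leaf_operator P g c p)) \<subseteq> leaf_tangent P c p"
    by (auto simp: leaf_tangent_def leaf_operator_def simp flip: matrix_vector_mul_assoc)
  ultimately show ?thesis by (rule equalityI)
qed

text \<open>Symmetry of \<open>g\<close> and skew-symmetry of \<open>P\<close> move both to the
  other side of the inner product, turning orthogonality to all \<open>P \<alpha>\<close> into
  \<open>P g u = 0\<close>.\<close>

lemma normal_space_eq_kernel:
  assumes "transpose (P c p) = - P c p" "transpose (g c p) = g c p"
  shows "normal_space P g c p = {u. leaf_operator P g c p *v u = 0}"
proof -
  have P: "w v* P c p = - (P c p *v w)" for w
    using matrix_vector_mult_diff_rdistrib[of 0 "P c p" w] assms(1)
    by (simp flip: transpose_matrix_vector)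
  have g: "u v* g c p = g c p *v u" for u
    using assms(2) by (simp flip: transpose_matrix_vector)
  have "u \<bullet> (g c p *v (P c p *v \<alpha>)) = - ((leaf_operator P g c p *v u) \<bullet> \<alpha>)" for u \<alpha>
    by (simp add: leaf_operator_def P g flip: dot_lmul_matrix matrix_vector_mul_assoc)
  moreover have "(\<forall>\<alpha>. w \<bullet> \<alpha> = 0) \<longleftrightarrow> w = 0" for w :: "real ^ 'k::finite"
    by (metis inner_eq_zero_iff inner_zero_left)
  ultimately show ?thesis
    by (auto simp: normal_space_def leaf_tangent_def)
qed

text \<open>The constant curve joins \<open>p\<close> to itself. Hence the assumption on the leaves
  is available at every point of the manifold.\<close>

lemma in_symplectic_leaf: "\<exists>S \<in> symplectic_leaves \<A> P. p \<in> S"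
proof -
  have "(0 :: real ^ 'b) \<in> leaf_tangent P c p" for c
    unfolding leaf_tangent_def by (metis matrix_vector_mult_0_right rangeI)
  then have "leaf_curve \<A> P (\<lambda>_. p)"
    unfolding leaf_curve_def
    by (auto intro!: bexI[of _ 0] has_vector_derivative_const)
  then have "p \<in> {q. \<exists>\<gamma>. leaf_curve \<A> P \<gamma> \<and> \<gamma> 0 = p \<and> \<gamma> 1 = q}"
    by blast
  then show ?thesis unfolding symplectic_leaves_def by (rule bexI) simp
qed

lemma range_kernel_disjoint_leaf_operator:
  assumes "\<forall>S\<in>symplectic_leaves \<A> P. nondegenerate_on_leaf \<A> P g S"
    and "c \<in> \<A>" "p \<in> chart_dom c" "transpose (P c p) = - P c p"
    and "transpose (g c p) = g c p" "invertible (g c p)"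
  shows "range_kernel_disjoint (leaf_operator P g c p)"
proof -
  have "u = 0" if "u \<in> leaf_tangent P c p" "u \<in> normal_space P g c p" for u
    using in_symplectic_leaf[of \<A> P p] assms(1-3) that
    unfolding nondegenerate_on_leaf_def normal_space_def by blast
  then show ?thesis
    unfolding leaf_tangent_eq_range[of g c p, OF assms(6)] normal_space_eq_kernel[of P c p g, OF assms(4,5)]
      range_kernel_disjoint_def by blast
qed

text \<open>Existence and uniqueness make the description in \<open>leaf_projection\<close>
  meaningful, once its two conditions are rewritten as range and kernel of \<open>A\<close>.\<close>

lemma range_kernel_projection_leaf:
  assumes "range_kernel_disjoint (leaf_operator P g c p)" "transpose (P c p) = - P c p"
    and "transpose (g c p) = g c p" "invertible (g c p)"
  shows "range_kernel_projection (leaf_operator P g c p) (leaf_projection P g c p)"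
proof -
  let ?A = "leaf_operator P g c p"
  obtain V where V: "range_kernel_projection ?A V"
    using range_kernel_projection_exists[OF assms(1)] by blast
  have "V' = V" if "range_kernel_projection ?A V'" for V'
    using that V unfolding matrix_eq
    by (metis assms(1) range_kernel_projection_def range_kernel_projection_unique)
  with V have "\<exists>!V. range_kernel_projection ?A V" by blast
  then have "range_kernel_projection ?A (THE V. range_kernel_projection ?A V)"
    by (rule theI')
  then show ?thesis
    unfolding leaf_projection_def leaf_tangent_eq_range[of g c p, OF assms(4)]
      normal_space_eq_kernel[of P c p g, OF assms(2,3)]
    by (simp add: range_kernel_projection_def)
qed

section \<open>The family of automorphisms and the vanishing criterion\<close>

theorem theorem2:
  fixes \<A> :: "('m::{t2_space, second_countable_topology}, 'n::finite) chart set"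
    and P g A v :: "('m, 'n) mat_comps"
    and k :: nat
  assumes "smooth_atlas \<A>"
    and "poisson_bivector \<A> P"
    and "constant_rank \<A> P k" "2 \<le> k" "k < CARD('n)"
    and "pseudo_riemannian_metric \<A> g"
    and "\<forall>S\<in>symplectic_leaves \<A> P. nondegenerate_on_leaf \<A> P g S"
    and A_def: "A = leaf_operator P g"
    and v_def: "v = leaf_projection P g"
  shows "(\<exists>D. tangent_automorphism \<A> D \<and> bracket_from_torsion \<A> P g A v D)
    \<and> (\<exists>D D'. tangent_automorphism \<A> D \<and> bracket_from_torsion \<A> P g A v D
          \<and> tangent_automorphism \<A> D' \<and> bracket_from_torsion \<A> P g A v D'
          \<and> \<not> fields_eq \<A> D D')
    \<and> ((\<forall>\<xi>\<in>normal_sections \<A> P g. \<forall>\<eta>\<in>normal_sections \<A> P g.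
           fields_eq \<A> (nijenhuis_torsion v \<xi> \<eta>) (\<lambda>c p. 0))
       \<longleftrightarrow> (\<forall>\<xi>\<in>normal_sections \<A> P g. \<forall>\<eta>\<in>normal_sections \<A> P g.
           fields_eq \<A> (apply_11 A (lie_bracket \<xi> \<eta>)) (\<lambda>c p. 0)))"
proof -
  let ?N = "normal_sections \<A> P g"
  have chart: "is_chart c" if "c \<in> \<A>" for c
    using assms(1) that by (simp add: smooth_atlas_def)
  have P: "transpose (P c p) = - P c p" and g: "transpose (g c p) = g c p" "invertible (g c p)"
    if "c \<in> \<A>" "p \<in> chart_dom c" for c p
    using assms(2,6) that by (auto simp: poisson_bivector_def pseudo_riemannian_metric_def)
  have disj: "range_kernel_disjoint (A c p)" if "c \<in> \<A>" "p \<in> chart_dom c" for c p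
    unfolding A_def
    by (rule range_kernel_disjoint_leaf_operator[OF assms(7) that P[OF that] g[OF that]])
  have proj: "range_kernel_projection (A c p) (v c p)" if "c \<in> \<A>" "p \<in> chart_dom c" for c p
    unfolding A_def v_def by (rule range_kernel_projection_leaf) (use disj P g that in \<open>simp_all flip: A_def\<close>)
  have rank: "rank (A c p) = k" if "c \<in> \<A>" "p \<in> chart_dom c" for c p
  proof -
    \<comment> \<open>\<open>A\<close> and \<open>P\<close> have the same range because
      \<open>g\<close> is invertible; so constancy of the rank passes to \<open>A\<close>.\<close>
    have "rank (A c p) = rank (P c p)"
      using leaf_tangent_eq_range[of g c p P, OF g(2)[OF that]]
      by (simp only: A_def rank_dim_range leaf_tangent_def)
    then show ?thesis using assms(3) that by (simp add: constant_rank_def)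
  qed
  have A: "tensor_field_11 \<A> A"
    unfolding A_def using chart assms(2,6)
    by (intro tensor_field_11_leaf_operator)
      (auto simp: poisson_bivector_def pseudo_riemannian_metric_def)
  have v: "tensor_field_11 \<A> v"
    by (rule tensor_field_11_projection[OF chart A disj proj rank])
  have vN: "v c p *v \<xi> c p = 0" if "\<xi> \<in> ?N" "c \<in> \<A>" "p \<in> chart_dom c" for \<xi> c p
  proof (rule projection_of_kernel[OF disj[OF that(2,3)] proj[OF that(2,3)]])
    show "A c p *v \<xi> c p = 0"
      using that(1) normal_space_eq_kernel[of P c p g, OF P[OF that(2,3)] g(1)[OF that(2,3)]] that(2,3)
      unfolding normal_sections_def A_def by blast
  qed
  have N: "nijenhuis_torsion v \<xi> \<eta> c p = v c p *v lie_bracket \<xi> \<eta> c p"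
    if "\<xi> \<in> ?N" "\<eta> \<in> ?N" "c \<in> \<A>" "p \<in> chart_dom c" for \<xi> \<eta> c p
    using nijenhuis_torsion_of_kernel[OF chart[OF that(3)] that(4), of v \<xi> \<eta>] vN that
      projection_idem[OF disj[OF that(3,4)] proj[OF that(3,4)]] by simp
  \<comment> \<open>Every nonzero \<open>t\<close> will do; the values 1 and 2 witness
    non-uniqueness.\<close>
  define D where "D t = (\<lambda>c p. A c p + t *\<^sub>R (mat 1 - v c p))" for t :: real
  have D: "tangent_automorphism \<A> (D t)" if "t \<noteq> 0" for t
    using tensor_field_11_deformation[OF chart A v] invertible_deformation[OF disj proj that]
    unfolding tangent_automorphism_def D_def by blast
  \<comment> \<open>On the range of \<open>v\<close> the term with \<open>1 - v\<close> vanishes,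
    and \<open>A v = A\<close>.\<close>
  have "D t c p *v (v c p *v u) = A c p *v u" if "c \<in> \<A>" "p \<in> chart_dom c" for t c p u
    using projection_idem[OF disj[OF that] proj[OF that]]
      mult_projection[OF disj[OF that] proj[OF that]]
    by (simp add: D_def matrix_vector_mult_add_rdistrib matrix_vector_mult_diff_rdistrib
        flip: scaleR_matrix_vector_assoc)
  then have B: "bracket_from_torsion \<A> P g A v (D t)" for t
    using N by (simp add: bracket_from_torsion_def fields_eq_def apply_11_def)
  have "\<not> fields_eq \<A> (D 1) (D 2)"
  proof
    assume eq: "fields_eq \<A> (D 1) (D 2)"
    obtain c p where c: "c \<in> \<A>" "p \<in> chart_dom c"
      using assms(1) unfolding smooth_atlas_def by blast
    \<comment> \<open>Equality of the two automorphisms at one point forces \<open>1 - v = 0\<close>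
      there, so \<open>A\<close> would have full rank, against \<open>k < CARD('n)\<close>.\<close>
    with eq have "mat 1 - v c p = 2 *\<^sub>R (mat 1 - v c p)"
      by (simp add: fields_eq_def D_def)
    then have "v c p = mat 1" by (simp add: scaleR_2)
    then have "rank (A c p) = CARD('n)"
      using rank_projection[OF disj[OF c] proj[OF c]] by (simp add: rank_dim_range)
    then show False using rank c assms(5) by simp
  qed
  \<comment> \<open>\<open>v\<close> and \<open>A\<close> have the same kernel, so the two vanishing
    conditions agree pointwise for each pair of sections.\<close>
  moreover have "v c p *v u = 0 \<longleftrightarrow> A c p *v u = 0" if "c \<in> \<A>" "p \<in> chart_dom c" for c p u
    using projection_of_kernel[OF disj[OF that] proj[OF that]]
      mult_projection[OF disj[OF that] proj[OF that]]
    by (metis matrix_vector_mult_0_right)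
  then have "fields_eq \<A> (nijenhuis_torsion v \<xi> \<eta>) (\<lambda>c p. 0)
      \<longleftrightarrow> fields_eq \<A> (apply_11 A (lie_bracket \<xi> \<eta>)) (\<lambda>c p. 0)"
    if "\<xi> \<in> ?N" "\<eta> \<in> ?N" for \<xi> \<eta>
    using N that by (simp add: fields_eq_def apply_11_def)
  ultimately show ?thesis
    using D[of 1] D[of 2] B[of 1] B[of 2] by auto
qed

end
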